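(* Let $G$ be a finite group. If $G=NA$, where $N$ and $A$ are two abelian subgroups of $G$ and $N$ is normal in $G$, then $G$ is an IYB group. In particular, every abelian-by-cyclic finite group (that is, every finite group with an abelian normal subgroup having cyclic quotient) is an IYB group.
   Context: $\mathrm{Fa}_n$ is the free abelian group (written multiplicatively) with basis $u_1,\dots,u_n$, and $\mathrm{Fa}_n\rtimes \mathrm{Sym}_n$ is the semidirect product for the natural action $\sigma(u_i)=u_{\sigma(i)}$, where $\mathrm{Sym}_n$ is the symmetric group of degree $n$. A finite group $G$ is an involutive Yang-Baxter (IYB) group if for some positive integer $n$ there is a map $\phi:\mathrm{Fa}_n\to \mathrm{Sym}_n$ such that $\{(a,\phi(a)) : a\in \mathrm{Fa}_n\}$ is a subgroup of $\mathrm{Fa}_n\rtimes \mathrm{Sym}_n$ and $G\cong\phi(\mathrm{Fa}_n)$. *)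

theory Defs
  imports "HOL-Algebra.Algebra"
begin

definition semidirect_product ::
  "('a, 'c) monoid_scheme \<Rightarrow> ('b, 'd) monoid_scheme \<Rightarrow> ('b \<Rightarrow> 'a \<Rightarrow> 'a) \<Rightarrow> ('a \<times> 'b) monoid"
  where "semidirect_product N H \<alpha> =
    \<lparr> carrier = carrier N \<times> carrier H,
      monoid.mult = (\<lambda>(a, s) (b, t). (a \<otimes>\<^bsub>N\<^esub> \<alpha> s b, s \<otimes>\<^bsub>H\<^esub> t)),
      one = (\<one>\<^bsub>N\<^esub>, \<one>\<^bsub>H\<^esub>) \<rparr>"

text \<open>The basis element \<open>u\<^sub>i\<close> is \<open>frag_of i\<close>. The library's free abelian group is a
  multiplicative structure whose operation is the addition of finitely supported integer-valued
  functions.\<close>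

abbreviation Fa :: "nat \<Rightarrow> (nat \<Rightarrow>\<^sub>0 int) monoid"
  where "Fa n \<equiv> free_Abelian_group {1..n}"

text \<open>The action of a permutation is the homomorphic extension of \<open>frag_of i \<mapsto> frag_of (s i)\<close>.\<close>

definition basis_action :: "(nat \<Rightarrow> nat) \<Rightarrow> (nat \<Rightarrow>\<^sub>0 int) \<Rightarrow> (nat \<Rightarrow>\<^sub>0 int)"
  where "basis_action s = frag_extend (\<lambda>i. frag_of (s i))"

definition Fa_Sym :: "nat \<Rightarrow> ((nat \<Rightarrow>\<^sub>0 int) \<times> (nat \<Rightarrow> nat)) monoid"
  where "Fa_Sym n = semidirect_product (Fa n) (sym_group n) basis_action"

definition IYB_group :: "('a, 'b) monoid_scheme \<Rightarrow> bool"
  where "IYB_group G \<longleftrightarrow> group G \<and> finite (carrier G) \<and>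
    (\<exists>n>0. \<exists>\<phi> \<in> carrier (Fa n) \<rightarrow> carrier (sym_group n).
       subgroup {(a, \<phi> a) |a. a \<in> carrier (Fa n)} (Fa_Sym n) \<and>
       G \<cong> (sym_group n)\<lparr>carrier := \<phi> ` carrier (Fa n)\<rparr>)"

definition abelian_by_cyclic :: "('a, 'b) monoid_scheme \<Rightarrow> bool"
  where "abelian_by_cyclic G \<longleftrightarrow>
    (\<exists>N. N \<lhd> G \<and> comm_group (G\<lparr>carrier := N\<rparr>) \<and> cyclic_group (G Mod N))"

lemma group_semidirect_product:
  assumes N: "group N" and H: "group H"
    and hom: "\<And>s. s \<in> carrier H \<Longrightarrow> \<alpha> s \<in> hom N N"
    and one: "\<And>a. a \<in> carrier N \<Longrightarrow> \<alpha> \<one>\<^bsub>H\<^esub> a = a"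
    and mult: "\<And>s t a. \<lbrakk>s \<in> carrier H; t \<in> carrier H; a \<in> carrier N\<rbrakk>
      \<Longrightarrow> \<alpha> (s \<otimes>\<^bsub>H\<^esub> t) a = \<alpha> s (\<alpha> t a)"
  shows "group (semidirect_product N H \<alpha>)"
proof -
  interpret N: group N by fact
  interpret H: group H by fact
  have cl: "\<alpha> s a \<in> carrier N" if "s \<in> carrier H" "a \<in> carrier N" for s a
    using hom[OF that(1)] that(2) by (auto simp: hom_def)
  have hm: "\<alpha> s (a \<otimes>\<^bsub>N\<^esub> b) = \<alpha> s a \<otimes>\<^bsub>N\<^esub> \<alpha> s b"
    if "s \<in> carrier H" "a \<in> carrier N" "b \<in> carrier N" for s a b
    using hom[OF that(1)] that(2,3) by (auto simp: hom_def)
  show ?thesis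
  proof (rule groupI)
    fix x assume "x \<in> carrier (semidirect_product N H \<alpha>)"
    then obtain a s where x: "x = (a, s)" and a: "a \<in> carrier N" and s: "s \<in> carrier H"
      by (auto simp: semidirect_product_def)
    let ?s = "inv\<^bsub>H\<^esub> s"
    let ?y = "(\<alpha> ?s (inv\<^bsub>N\<^esub> a), ?s)"
    have "\<alpha> ?s (inv\<^bsub>N\<^esub> a) \<otimes>\<^bsub>N\<^esub> \<alpha> ?s a = \<one>\<^bsub>N\<^esub>"
      using a s hm[of ?s "inv\<^bsub>N\<^esub> a" a] group_hom.hom_one[of N N "\<alpha> ?s"] hom[of ?s]
      by (simp add: group_hom_def group_hom_axioms_def N)
    then show "\<exists>y\<in>carrier (semidirect_product N H \<alpha>).
        y \<otimes>\<^bsub>semidirect_product N H \<alpha>\<^esub> x = \<one>\<^bsub>semidirect_product N H \<alpha>\<^esub>"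
      using a s cl x by (intro bexI[of _ ?y]) (auto simp: semidirect_product_def)
  qed (auto simp: semidirect_product_def cl hm mult one N.m_assoc H.m_assoc)
qed

lemma group_Fa_Sym: "group (Fa_Sym n)"
  unfolding Fa_Sym_def
proof (rule group_semidirect_product)
  show "group (Fa n)" by simp
  show "group (sym_group n)" by (rule sym_group_is_group)
next
  fix s assume "s \<in> carrier (sym_group n)"
  then have s: "s permutes {1..n}" by (simp add: sym_group_carrier)
  have "Poly_Mapping.keys (basis_action s a) \<subseteq> {1..n}" if "Poly_Mapping.keys a \<subseteq> {1..n}" for a
    using keys_frag_extend[of "\<lambda>i. frag_of (s i)" a] that permutes_in_image[OF s]
    unfolding basis_action_def by fastforce
  then show "basis_action s \<in> hom (Fa n) (Fa n)"
    by (auto simp: hom_def basis_action_def frag_extend_add)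
next
  fix a show "basis_action \<one>\<^bsub>sym_group n\<^esub> a = a"
    by (simp add: sym_group_one basis_action_def flip: frag_expansion)
next
  fix s t a
  show "basis_action (s \<otimes>\<^bsub>sym_group n\<^esub> t) a = basis_action s (basis_action t a)"
    using frag_extend_compose[of "\<lambda>i. frag_of (s i)" t]
    by (simp add: sym_group_mult basis_action_def o_def fun_eq_iff)
qed

end

theory Submission
  imports Defs
begin

text \<open>
  The link between the given factorization and permutation groups is a left brace: a second,
  commutative group operation \<open>+\<close> on the carrier of \<open>G\<close> and a map \<open>lam\<close> from \<open>G\<close> to the
  automorphisms of \<open>(G, +)\<close> with \<open>x y = x + lam x y\<close>.

  A brace gives the map \<open>\<phi>\<close>. The group \<open>G\<close> acts on \<open>Y = G \<times> G\<close> by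
  \<open>g (x, y) = (lam g x, g y)\<close>: the second coordinate makes the action faithful, and the first
  coordinate extends to an equivariant surjective homomorphism \<open>p\<close> from the free abelian group on
  \<open>Y\<close> onto \<open>(G, +)\<close>. Let \<open>\<phi> a\<close> be the permutation of \<open>Y\<close> given by \<open>p a\<close>. Then
  \<open>p (a + \<phi> a b) = p a + lam (p a) (p b) = p a p b\<close>, so \<open>\<phi> (a + \<phi> a b) = \<phi> a \<circ> \<phi> b\<close>. This says
  exactly that the graph of \<open>\<phi>\<close> is closed under the product of the semidirect product. The image of
  \<open>\<phi>\<close> is the faithful image of \<open>G\<close>.

  The factorization \<open>G = N A\<close> gives the brace. Write \<open>x = \<nu> x \<alpha> x\<close> with \<open>\<nu> x \<in> N\<close> and
  \<open>\<alpha> x \<in> A\<close>, and put \<open>x + y = \<nu> x y \<alpha> x = \<nu> x \<nu> y \<alpha> y \<alpha> x\<close> and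
  \<open>lam x y = \<alpha> x y (\<alpha> x)\<inverse>\<close>. Then \<open>x + lam x y = \<nu> x \<alpha> x y = x y\<close>. The choice of the
  factors does not affect the sum: two choices differ by an element of \<open>N \<inter> A\<close>, which is central
  because it commutes with both factors. This independence yields associativity of \<open>+\<close> and
  additivity of \<open>lam\<close>, and commutativity of \<open>+\<close> is that of \<open>N\<close> and \<open>A\<close>.

  If \<open>G / N\<close> is cyclic, then a representative of a generator generates a cyclic subgroup \<open>A\<close> with
  \<open>G = N A\<close>.
\<close>

section \<open>Left braces\<close>

text \<open>
  The structure \<open>B\<close> is the additive group of the brace. The axioms say that the identity map is a
  bijective 1-cocycle from \<open>G\<close> to \<open>B\<close>, on which \<open>G\<close> acts by \<open>lam\<close>.
\<close>

locale left_brace = G: group G + B: comm_group B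
  for G :: "('a, 'b) monoid_scheme" and B :: "('a, 'c) monoid_scheme"
    and lam :: "'a \<Rightarrow> 'a \<Rightarrow> 'a" +
  assumes same_carrier: "carrier B = carrier G"
    and lam_hom: "g \<in> carrier G \<Longrightarrow> lam g \<in> hom B B"
    and mult_eq: "\<lbrakk>x \<in> carrier G; y \<in> carrier G\<rbrakk> \<Longrightarrow> x \<otimes>\<^bsub>G\<^esub> y = x \<otimes>\<^bsub>B\<^esub> lam x y"
begin

lemma lam_closed: "\<lbrakk>g \<in> carrier G; x \<in> carrier G\<rbrakk> \<Longrightarrow> lam g x \<in> carrier G"
  using lam_hom same_carrier by (metis hom_in_carrier)

lemma lam_group_hom: "g \<in> carrier G \<Longrightarrow> group_hom B B (lam g)"
  using lam_hom by (simp add: group_hom_def group_hom_axioms_def B.is_group)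

lemma one_eq: "\<one>\<^bsub>G\<^esub> = \<one>\<^bsub>B\<^esub>"
proof -
  have B1: "\<one>\<^bsub>B\<^esub> \<in> carrier G" using B.one_closed same_carrier by simp
  have "\<one>\<^bsub>B\<^esub> = \<one>\<^bsub>G\<^esub> \<otimes>\<^bsub>G\<^esub> \<one>\<^bsub>B\<^esub>" using B1 by simp
  also have "\<dots> = \<one>\<^bsub>G\<^esub> \<otimes>\<^bsub>B\<^esub> lam \<one>\<^bsub>G\<^esub> \<one>\<^bsub>B\<^esub>" by (rule mult_eq[OF G.one_closed B1])
  also have "\<dots> = \<one>\<^bsub>G\<^esub>"
    using group_hom.hom_one[OF lam_group_hom[OF G.one_closed]] same_carrier by simp
  finally show ?thesis by simp
qed

lemma lam_one: "x \<in> carrier G \<Longrightarrow> lam \<one>\<^bsub>G\<^esub> x = x"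
  using mult_eq[OF G.one_closed, of x] B.l_one[of "lam \<one>\<^bsub>G\<^esub> x"]
    lam_closed[OF G.one_closed, of x] same_carrier one_eq
  by (metis G.l_one)

text \<open>Both sides complete \<open>x y\<close> to the same sum, namely \<open>x (y z)\<close> expanded in two ways.\<close>

lemma lam_mult:
  assumes x: "x \<in> carrier G" and y: "y \<in> carrier G" and z: "z \<in> carrier G"
  shows "lam (x \<otimes>\<^bsub>G\<^esub> y) z = lam x (lam y z)"
proof -
  note cl = x y z lam_closed G.m_closed
  have "(x \<otimes>\<^bsub>G\<^esub> y) \<otimes>\<^bsub>B\<^esub> lam (x \<otimes>\<^bsub>G\<^esub> y) z = x \<otimes>\<^bsub>G\<^esub> (y \<otimes>\<^bsub>G\<^esub> z)"
    using x y z by (simp add: G.m_assoc flip: mult_eq)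
  also have "\<dots> = x \<otimes>\<^bsub>B\<^esub> lam x (y \<otimes>\<^bsub>B\<^esub> lam y z)"
    using mult_eq[OF x G.m_closed[OF y z]] mult_eq[OF y z] by simp
  also have "\<dots> = (x \<otimes>\<^bsub>G\<^esub> y) \<otimes>\<^bsub>B\<^esub> lam x (lam y z)"
    using cl hom_mult[OF lam_hom[OF x], of y "lam y z"] same_carrier
    by (simp add: B.m_assoc mult_eq)
  finally show ?thesis
    using cl same_carrier by (simp add: B.l_cancel)
qed

section \<open>From left braces to involutive Yang-Baxter groups\<close>

text \<open>
  The labelling \<open>c\<close> extends to a homomorphism \<open>p\<close> onto the additive group, and \<open>\<phi> = \<sigma> \<circ> p\<close> is
  the required map. Equivariance of \<open>c\<close> passes to \<open>p\<close>, which turns the brace identity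
  \<open>x y = x + lam x y\<close> into closure of the graph of \<open>\<phi>\<close>. Surjectivity of \<open>c\<close> and injectivity of
  \<open>\<sigma>\<close> identify the image of \<open>\<phi>\<close> with \<open>G\<close>.
\<close>

lemma IYB_group_if_equivariant_labelling:
  assumes fin: "finite (carrier G)" and n: "n > 0"
    and \<sigma>: "\<sigma> \<in> hom G (sym_group n)" "inj_on \<sigma> (carrier G)"
    and c: "c ` {1..n} = carrier G"
    and equiv: "\<And>g i. \<lbrakk>g \<in> carrier G; i \<in> {1..n}\<rbrakk> \<Longrightarrow> c (\<sigma> g i) = lam g (c i)"
  shows "IYB_group G"
proof -
  obtain p where p: "p \<in> hom (Fa n) B" and p_basis: "\<And>i. i \<in> {1..n} \<Longrightarrow> p (frag_of i) = c i"
    using B.free_Abelian_group_universal[of c "{1..n}"] c same_carrier by auto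
  interpret p: group_hom "Fa n" B p
    using p by (simp add: group_hom_def group_hom_axioms_def B.is_group)
  interpret S: group "sym_group n" by (rule sym_group_is_group)
  interpret FS: group "Fa_Sym n" by (rule group_Fa_Sym)
  interpret s: group_hom G "sym_group n" \<sigma>
    using \<sigma>(1) by (simp add: group_hom_def group_hom_axioms_def G.is_group S.is_group)
  have perm: "\<sigma> g permutes {1..n}" if "g \<in> carrier G" for g
    using s.hom_closed[OF that] by (simp add: sym_group_carrier)
  have act_closed: "Poly_Mapping.keys (basis_action (\<sigma> g) a) \<subseteq> {1..n}"
    if "g \<in> carrier G" "Poly_Mapping.keys a \<subseteq> {1..n}" for g a
    using keys_frag_extend[of "\<lambda>i. frag_of (\<sigma> g i)" a] that permutes_in_image[OF perm]
    unfolding basis_action_def by fastforce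
  have p_closed: "p a \<in> carrier G" if "Poly_Mapping.keys a \<subseteq> {1..n}" for a
    using p.hom_closed[of a] that same_carrier by simp
  have p_diff: "p (a - b) = p a \<otimes>\<^bsub>B\<^esub> inv\<^bsub>B\<^esub> p b"
    if "Poly_Mapping.keys a \<subseteq> {1..n}" "Poly_Mapping.keys b \<subseteq> {1..n}" for a b
    using p.hom_mult[of a "-b"] p.hom_inv[of b] that by simp
  have p_equiv: "p (basis_action (\<sigma> g) a) = lam g (p a)"
    if g: "g \<in> carrier G" and a: "Poly_Mapping.keys a \<subseteq> {1..n}" for g a
  proof (rule free_Abelian_group_induct[OF a])
    show "p (basis_action (\<sigma> g) 0) = lam g (p 0)"
      using p.hom_one group_hom.hom_one[OF lam_group_hom[OF g]] by (simp add: basis_action_def)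
  next
    fix x y :: "nat \<Rightarrow>\<^sub>0 int"
    assume xy: "Poly_Mapping.keys x \<subseteq> {1..n}" "Poly_Mapping.keys y \<subseteq> {1..n}"
      and IH: "p (basis_action (\<sigma> g) x) = lam g (p x)" "p (basis_action (\<sigma> g) y) = lam g (p y)"
    interpret l: group_hom B B "lam g" by (rule lam_group_hom[OF g])
    have "basis_action (\<sigma> g) (x - y) = basis_action (\<sigma> g) x - basis_action (\<sigma> g) y"
      by (simp add: basis_action_def frag_extend_diff)
    moreover have "p x \<in> carrier B" "p y \<in> carrier B"
      using xy p.hom_closed by simp_all
    ultimately show "p (basis_action (\<sigma> g) (x - y)) = lam g (p (x - y))"
      using xy IH act_closed[OF g] by (simp add: p_diff)
  next
    fix i assume "i \<in> {1..n}"
    then show "p (basis_action (\<sigma> g) (frag_of i)) = lam g (p (frag_of i))"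
      using p_basis[of i] p_basis[of "\<sigma> g i"] permutes_in_image[OF perm[OF g], of i]
        equiv[OF g, of i]
      by (simp add: basis_action_def)
  qed
  define \<phi> where "\<phi> a = \<sigma> (p a)" for a
  have p_image: "p ` carrier (Fa n) = carrier G"
  proof
    show "p ` carrier (Fa n) \<subseteq> carrier G" using p_closed by auto
    show "carrier G \<subseteq> p ` carrier (Fa n)"
    proof
      fix x assume "x \<in> carrier G"
      then obtain i where "i \<in> {1..n}" "c i = x" using c by (metis imageE)
      then show "x \<in> p ` carrier (Fa n)"
        using p_basis[of i] by (intro image_eqI[of _ _ "frag_of i"]) auto
    qed
  qed
  have \<phi>_in: "\<phi> \<in> carrier (Fa n) \<rightarrow> carrier (sym_group n)"
    using p_closed s.hom_closed by (auto simp: \<phi>_def)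
  have Fa_Sym_mult: "(a, s) \<otimes>\<^bsub>Fa_Sym n\<^esub> (b, t) = (a + basis_action s b, s \<circ> t)" for a b s t
    by (simp add: Fa_Sym_def semidirect_product_def sym_group_mult)
  have Fa_Sym_one: "\<one>\<^bsub>Fa_Sym n\<^esub> = (0, id)"
    by (simp add: Fa_Sym_def semidirect_product_def sym_group_one)
  have Fa_Sym_carrier: "(a, s) \<in> carrier (Fa_Sym n) \<longleftrightarrow>
      Poly_Mapping.keys a \<subseteq> {1..n} \<and> s \<in> carrier (sym_group n)" for a s
    by (simp add: Fa_Sym_def semidirect_product_def)
  have cocycle: "\<phi> (a + basis_action (\<phi> a) b) = \<phi> a \<circ> \<phi> b"
    if a: "Poly_Mapping.keys a \<subseteq> {1..n}" and b: "Poly_Mapping.keys b \<subseteq> {1..n}" for a b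
  proof -
    have "p (a + basis_action (\<phi> a) b) = p a \<otimes>\<^bsub>B\<^esub> lam (p a) (p b)"
      using p.hom_mult[of a "basis_action (\<phi> a) b"] a b act_closed[OF p_closed[OF a] b]
        p_equiv[OF p_closed[OF a] b] by (simp add: \<phi>_def)
    then show ?thesis
      using s.hom_mult[OF p_closed[OF a] p_closed[OF b]] mult_eq[OF p_closed[OF a] p_closed[OF b]]
      by (simp add: \<phi>_def sym_group_mult)
  qed
  have keys_sum: "Poly_Mapping.keys (a + b) \<subseteq> {1..n}"
    if "Poly_Mapping.keys a \<subseteq> {1..n}" "Poly_Mapping.keys b \<subseteq> {1..n}" for a b :: "nat \<Rightarrow>\<^sub>0 int"
    using that by (meson Un_least keys_add order_trans)
  let ?K = "{(a, \<phi> a) |a. a \<in> carrier (Fa n)}"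
  have "subgroup ?K (Fa_Sym n)"
  proof (rule FS.subgroupI)
    show "?K \<subseteq> carrier (Fa_Sym n)"
      using \<phi>_in by (auto simp: Fa_Sym_carrier)
    show "?K \<noteq> {}" by (auto intro: exI[of _ 0])
  next
    fix u assume "u \<in> ?K"
    then obtain a where u: "u = (a, \<phi> a)" and a: "Poly_Mapping.keys a \<subseteq> {1..n}" by auto
    \<comment> \<open>Inverses in a semidirect product have the form \<open>(s\<inverse> (-a), s\<inverse>)\<close>.\<close>
    define g where "g = inv\<^bsub>G\<^esub> (p a)"
    have g: "g \<in> carrier G" using p_closed[OF a] by (simp add: g_def)
    define b where "b = basis_action (\<sigma> g) (- a)"
    have b: "Poly_Mapping.keys b \<subseteq> {1..n}" unfolding b_def using act_closed[OF g, of "-a"] a by simp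
    have "\<phi> a \<circ> \<sigma> g = id"
      using s.hom_mult[OF p_closed[OF a] g] p_closed[OF a] s.hom_one
      by (simp add: \<phi>_def g_def sym_group_mult sym_group_one)
    then have "basis_action (\<phi> a) b = - a"
      using frag_extend_compose[of "\<lambda>i. frag_of (\<phi> a i)" "\<sigma> g"]
      by (simp add: b_def basis_action_def o_def fun_eq_iff flip: frag_expansion)
    then have ab: "a + basis_action (\<phi> a) b = 0" by simp
    have "\<phi> 0 = id"
      using p.hom_one s.hom_one one_eq by (simp add: \<phi>_def sym_group_one)
    then have "u \<otimes>\<^bsub>Fa_Sym n\<^esub> (b, \<phi> b) = \<one>\<^bsub>Fa_Sym n\<^esub>"
      using cocycle[OF a b] ab by (simp add: u Fa_Sym_mult Fa_Sym_one)
    moreover have "u \<in> carrier (Fa_Sym n)" "(b, \<phi> b) \<in> carrier (Fa_Sym n)"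
      using a b \<phi>_in by (auto simp: u Fa_Sym_carrier)
    ultimately have "inv\<^bsub>Fa_Sym n\<^esub> u = (b, \<phi> b)"
      by (meson FS.inv_comm FS.inv_equality)
    then show "inv\<^bsub>Fa_Sym n\<^esub> u \<in> ?K" using b by auto
  next
    fix u v assume "u \<in> ?K" "v \<in> ?K"
    then obtain a b where uv: "u = (a, \<phi> a)" "v = (b, \<phi> b)"
      and ab: "Poly_Mapping.keys a \<subseteq> {1..n}" "Poly_Mapping.keys b \<subseteq> {1..n}" by auto
    have "Poly_Mapping.keys (a + basis_action (\<phi> a) b) \<subseteq> {1..n}"
      using keys_sum[OF ab(1) act_closed[OF p_closed[OF ab(1)] ab(2)]] by (simp add: \<phi>_def)
    then show "u \<otimes>\<^bsub>Fa_Sym n\<^esub> v \<in> ?K"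
      using cocycle[OF ab] by (auto simp: uv Fa_Sym_mult)
  qed
  moreover have "G \<cong> (sym_group n)\<lparr>carrier := \<phi> ` carrier (Fa n)\<rparr>"
  proof -
    have "\<phi> ` carrier (Fa n) = \<sigma> ` carrier G"
      using p_image by (simp add: \<phi>_def image_image flip: p_image)
    then have "\<sigma> \<in> iso G ((sym_group n)\<lparr>carrier := \<phi> ` carrier (Fa n)\<rparr>)"
      using \<sigma> by (auto simp: iso_iff hom_def)
    then show ?thesis by (rule is_isoI)
  qed
  ultimately show ?thesis
    unfolding IYB_group_def using G.is_group fin n \<phi>_in by blast
qed

text \<open>
  The action by \<open>lam\<close> alone need not be faithful (it is trivial if the two operations agree), so it
  is combined with the regular action of \<open>G\<close> on itself.
\<close>

theorem IYB_group:
  assumes fin: "finite (carrier G)"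
  shows "IYB_group G"
proof -
  define Y where "Y = carrier G \<times> carrier G"
  define n where "n = card Y"
  have finY: "finite Y" using fin by (simp add: Y_def)
  have n: "n > 0" using finY G.one_closed by (auto simp: n_def Y_def card_gt_0_iff)
  obtain f where f: "bij_betw f {1..n} Y"
    using ex_bij_betw_nat_finite_1[OF finY] n_def by auto
  define e where "e = inv_into {1..n} f"
  define act where "act g = (\<lambda>(x, y). (lam g x, g \<otimes>\<^bsub>G\<^esub> y))" for g
  define \<sigma> where "\<sigma> g i = (if i \<in> {1..n} then e (act g (f i)) else i)" for g i
  have fY: "f i \<in> Y" if "i \<in> {1..n}" for i using f that by (auto simp: bij_betw_def)
  have ef: "e (f i) = i" if "i \<in> {1..n}" for i
    using f that by (simp add: e_def bij_betw_def)
  have fe: "f (e x) = x" "e x \<in> {1..n}" if "x \<in> Y" for x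
    using f that bij_betw_inv_into_right[OF f that] bij_betw_inv_into[OF f]
    by (auto simp: e_def bij_betw_def)
  have actY: "act g x \<in> Y" if "g \<in> carrier G" "x \<in> Y" for g x
    using that lam_closed by (auto simp: act_def Y_def)
  have \<sigma>_in: "\<sigma> g i \<in> {1..n}" and f\<sigma>: "f (\<sigma> g i) = act g (f i)"
    if "g \<in> carrier G" "i \<in> {1..n}" for g i
    using fe[OF actY[OF that(1) fY[OF that(2)]]] that by (auto simp: \<sigma>_def)
  have \<sigma>_mult: "\<sigma> (g \<otimes>\<^bsub>G\<^esub> h) = \<sigma> g \<circ> \<sigma> h" if g: "g \<in> carrier G" and h: "h \<in> carrier G" for g h
  proof
    fix i show "\<sigma> (g \<otimes>\<^bsub>G\<^esub> h) i = (\<sigma> g \<circ> \<sigma> h) i"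
    proof (cases "i \<in> {1..n}")
      case True
      have "act (g \<otimes>\<^bsub>G\<^esub> h) (f i) = act g (act h (f i))"
        using fY[OF True] g h by (auto simp: act_def Y_def lam_mult G.m_assoc)
      then show ?thesis
        using True \<sigma>_in[OF h True] f\<sigma>[OF h True] by (simp add: \<sigma>_def)
    qed (auto simp: \<sigma>_def)
  qed
  have \<sigma>_one: "\<sigma> \<one>\<^bsub>G\<^esub> = id"
  proof
    fix i
    have "act \<one>\<^bsub>G\<^esub> (f i) = f i" if "i \<in> {1..n}"
      using fY[OF that] by (auto simp: act_def Y_def lam_one)
    then show "\<sigma> \<one>\<^bsub>G\<^esub> i = id i" by (auto simp: \<sigma>_def ef)
  qed
  have perm: "\<sigma> g permutes {1..n}" if g: "g \<in> carrier G" for g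
  proof (rule bij_imp_permutes)
    have "\<sigma> (inv\<^bsub>G\<^esub> g) (\<sigma> g i) = i" "\<sigma> g (\<sigma> (inv\<^bsub>G\<^esub> g) i) = i" for i
      using \<sigma>_mult[of g "inv\<^bsub>G\<^esub> g"] \<sigma>_mult[of "inv\<^bsub>G\<^esub> g" g] g \<sigma>_one
      by (auto simp: fun_eq_iff)
    then show "bij_betw (\<sigma> g) {1..n} {1..n}"
      using \<sigma>_in[OF g] \<sigma>_in[OF G.inv_closed[OF g]]
      by (intro bij_betw_byWitness[where f' = "\<sigma> (inv\<^bsub>G\<^esub> g)"]) auto
  qed (auto simp: \<sigma>_def)
  show ?thesis
  proof (rule IYB_group_if_equivariant_labelling[OF fin n])
    show "\<sigma> \<in> hom G (sym_group n)"
      using perm \<sigma>_mult by (auto simp: hom_def sym_group_carrier sym_group_mult)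
    show "inj_on \<sigma> (carrier G)"
    proof (rule inj_onI)
      fix g h assume g: "g \<in> carrier G" and h: "h \<in> carrier G" and eq: "\<sigma> g = \<sigma> h"
      have 1: "(\<one>\<^bsub>G\<^esub>, \<one>\<^bsub>G\<^esub>) \<in> Y" by (simp add: Y_def)
      have "act g (\<one>\<^bsub>G\<^esub>, \<one>\<^bsub>G\<^esub>) = act h (\<one>\<^bsub>G\<^esub>, \<one>\<^bsub>G\<^esub>)"
        using f\<sigma>[OF g fe(2)[OF 1]] f\<sigma>[OF h fe(2)[OF 1]] fe(1)[OF 1] eq by simp
      then show "g = h" using g h by (simp add: act_def)
    qed
    show "(fst \<circ> f) ` {1..n} = carrier G"
      using G.one_closed unfolding image_comp[symmetric] bij_betw_imp_surj_on[OF f] Y_def by force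
    show "(fst \<circ> f) (\<sigma> g i) = lam g ((fst \<circ> f) i)" if "g \<in> carrier G" "i \<in> {1..n}" for g i
      using f\<sigma>[OF that] by (simp add: act_def split: prod.splits)
  qed
qed

end

section \<open>The left brace of a product of abelian subgroups\<close>

text \<open>
  For \<open>N \<inter> A = 1\<close> this brace is the direct sum of \<open>N\<close> and \<open>A\<close>, where \<open>lam\<close> conjugates the
  summand \<open>N\<close> and fixes the summand \<open>A\<close>. In general it is the quotient of that brace by the central
  elements \<open>(d, d\<inverse>)\<close> with \<open>d \<in> N \<inter> A\<close>; chosen factors \<open>\<nu> x\<close> and \<open>\<alpha> x\<close> avoid forming
  the quotient.
\<close>

lemma left_brace_of_abelian_factorization:
  fixes G :: "('a, 'b) monoid_scheme"
  assumes "N \<lhd> G" and A: "subgroup A G"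
    and "comm_group (G\<lparr>carrier := N\<rparr>)" and "comm_group (G\<lparr>carrier := A\<rparr>)"
    and G_eq: "carrier G = N <#>\<^bsub>G\<^esub> A"
  obtains B :: "'a monoid" and lam where "left_brace G B lam"
proof -
  interpret N: normal N G by fact
  interpret A: subgroup A G by fact
  note [simp] = N.mem_carrier A.mem_carrier
  have N_comm: "m \<otimes>\<^bsub>G\<^esub> n = n \<otimes>\<^bsub>G\<^esub> m" if "m \<in> N" "n \<in> N" for m n
    using comm_monoid.m_comm[OF comm_group.axioms(1)[OF assms(3)]] that by simp
  have A_comm: "a \<otimes>\<^bsub>G\<^esub> b = b \<otimes>\<^bsub>G\<^esub> a" if "a \<in> A" "b \<in> A" for a b
    using comm_monoid.m_comm[OF comm_group.axioms(1)[OF assms(4)]] that by simp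
  have conj_N: "a \<otimes>\<^bsub>G\<^esub> n \<otimes>\<^bsub>G\<^esub> inv\<^bsub>G\<^esub> a \<in> N" if "a \<in> A" "n \<in> N" for a n
    using N.inv_op_closed2 that by simp
  have "\<exists>n a. n \<in> N \<and> a \<in> A \<and> x = n \<otimes>\<^bsub>G\<^esub> a" if "x \<in> carrier G" for x
    using that G_eq by (auto simp: set_mult_def)
  then obtain \<nu> \<alpha> where \<nu>: "\<And>x. x \<in> carrier G \<Longrightarrow> \<nu> x \<in> N"
    and \<alpha>: "\<And>x. x \<in> carrier G \<Longrightarrow> \<alpha> x \<in> A"
    and split: "\<And>x. x \<in> carrier G \<Longrightarrow> x = \<nu> x \<otimes>\<^bsub>G\<^esub> \<alpha> x"
    by metis
  have [simp]: "\<nu> x \<in> carrier G" "\<alpha> x \<in> carrier G" if "x \<in> carrier G" for x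
    using \<nu>[OF that] \<alpha>[OF that] by simp_all
  have central: "d \<otimes>\<^bsub>G\<^esub> x = x \<otimes>\<^bsub>G\<^esub> d" if d: "d \<in> N" "d \<in> A" and x: "x \<in> carrier G" for d x
  proof -
    have "d \<otimes>\<^bsub>G\<^esub> (\<nu> x \<otimes>\<^bsub>G\<^esub> \<alpha> x) = \<nu> x \<otimes>\<^bsub>G\<^esub> (d \<otimes>\<^bsub>G\<^esub> \<alpha> x)"
      using d x N_comm[OF d(1) \<nu>[OF x]] by (simp flip: N.m_assoc)
    also have "\<dots> = (\<nu> x \<otimes>\<^bsub>G\<^esub> \<alpha> x) \<otimes>\<^bsub>G\<^esub> d"
      using d x A_comm[OF d(2) \<alpha>[OF x]] by (simp add: N.m_assoc)
    finally show ?thesis using split[OF x] by simp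
  qed
  have ambiguity: "\<exists>d\<in>N \<inter> A. \<nu> (n \<otimes>\<^bsub>G\<^esub> a) = n \<otimes>\<^bsub>G\<^esub> d \<and> a = d \<otimes>\<^bsub>G\<^esub> \<alpha> (n \<otimes>\<^bsub>G\<^esub> a)"
    if n: "n \<in> N" and a: "a \<in> A" for n a
  proof -
    define x where "x = n \<otimes>\<^bsub>G\<^esub> a"
    have x: "x \<in> carrier G" using n a by (simp add: x_def)
    define d where "d = inv\<^bsub>G\<^esub> n \<otimes>\<^bsub>G\<^esub> \<nu> x"
    have nd: "\<nu> x = n \<otimes>\<^bsub>G\<^esub> d"
      using n x by (simp add: d_def flip: N.m_assoc)
    have d: "d \<in> carrier G" using n x by (simp add: d_def)
    have "n \<otimes>\<^bsub>G\<^esub> a = \<nu> x \<otimes>\<^bsub>G\<^esub> \<alpha> x" using split[OF x] by (simp only: x_def)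
    also have "\<dots> = n \<otimes>\<^bsub>G\<^esub> (d \<otimes>\<^bsub>G\<^esub> \<alpha> x)" using n d x by (simp add: nd N.m_assoc)
    finally have ad: "a = d \<otimes>\<^bsub>G\<^esub> \<alpha> x" using n a d x by simp
    then have "d = a \<otimes>\<^bsub>G\<^esub> inv\<^bsub>G\<^esub> \<alpha> x"
      using a d x by (simp add: N.inv_solve_right)
    then have "d \<in> A" using a \<alpha>[OF x] by simp
    moreover have "d \<in> N" using n \<nu>[OF x] by (simp add: d_def)
    ultimately show ?thesis using nd ad unfolding x_def by blast
  qed
  define add where "add x y = \<nu> x \<otimes>\<^bsub>G\<^esub> y \<otimes>\<^bsub>G\<^esub> \<alpha> x" for x y
  define lam where "lam g x = \<alpha> g \<otimes>\<^bsub>G\<^esub> x \<otimes>\<^bsub>G\<^esub> inv\<^bsub>G\<^esub> \<alpha> g" for g x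
  \<comment> \<open>Any factorization of the first summand computes the sum: the discrepancy \<open>d\<close> is central.\<close>
  have add_split: "add (n \<otimes>\<^bsub>G\<^esub> a) y = n \<otimes>\<^bsub>G\<^esub> y \<otimes>\<^bsub>G\<^esub> a"
    if n: "n \<in> N" and a: "a \<in> A" and y: "y \<in> carrier G" for n a y
  proof -
    let ?b = "\<alpha> (n \<otimes>\<^bsub>G\<^esub> a)"
    obtain d where d: "d \<in> N" "d \<in> A" "\<nu> (n \<otimes>\<^bsub>G\<^esub> a) = n \<otimes>\<^bsub>G\<^esub> d" "a = d \<otimes>\<^bsub>G\<^esub> ?b"
      using ambiguity[OF n a] by auto
    have b: "?b \<in> carrier G" using n a by simp
    have "add (n \<otimes>\<^bsub>G\<^esub> a) y = n \<otimes>\<^bsub>G\<^esub> (d \<otimes>\<^bsub>G\<^esub> y) \<otimes>\<^bsub>G\<^esub> ?b"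
      using n b y d(1) by (simp add: add_def d(3) N.m_assoc)
    also have "\<dots> = n \<otimes>\<^bsub>G\<^esub> y \<otimes>\<^bsub>G\<^esub> (d \<otimes>\<^bsub>G\<^esub> ?b)"
      using n b y d(1) central[OF d(1,2) y] by (simp add: N.m_assoc)
    finally show ?thesis using d(4) by simp
  qed
  have add_closed: "add x y \<in> carrier G" if "x \<in> carrier G" "y \<in> carrier G" for x y
    using that by (simp add: add_def)
  have add_eq: "add x y = (\<nu> x \<otimes>\<^bsub>G\<^esub> \<nu> y) \<otimes>\<^bsub>G\<^esub> (\<alpha> y \<otimes>\<^bsub>G\<^esub> \<alpha> x)"
    if x: "x \<in> carrier G" and y: "y \<in> carrier G" for x y
  proof -
    have "add x y = \<nu> x \<otimes>\<^bsub>G\<^esub> (\<nu> y \<otimes>\<^bsub>G\<^esub> \<alpha> y) \<otimes>\<^bsub>G\<^esub> \<alpha> x"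
      using split[OF y] by (simp add: add_def)
    then show ?thesis using x y by (simp add: N.m_assoc)
  qed
  have add_comm: "add x y = add y x" if "x \<in> carrier G" "y \<in> carrier G" for x y
    using that N_comm[OF \<nu> \<nu>] A_comm[OF \<alpha> \<alpha>] by (metis add_eq)
  have add_assoc: "add (add x y) z = add x (add y z)"
    if x: "x \<in> carrier G" and y: "y \<in> carrier G" and z: "z \<in> carrier G" for x y z
  proof -
    have "add (add x y) z = (\<nu> x \<otimes>\<^bsub>G\<^esub> \<nu> y) \<otimes>\<^bsub>G\<^esub> z \<otimes>\<^bsub>G\<^esub> (\<alpha> y \<otimes>\<^bsub>G\<^esub> \<alpha> x)"
      using add_split[of "\<nu> x \<otimes>\<^bsub>G\<^esub> \<nu> y" "\<alpha> y \<otimes>\<^bsub>G\<^esub> \<alpha> x" z] \<nu> \<alpha> x y z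
      by (simp add: add_eq)
    also have "\<dots> = add x (add y z)"
      using x y z by (simp add: add_def N.m_assoc)
    finally show ?thesis .
  qed
  have add_one: "add \<one>\<^bsub>G\<^esub> x = x" if x: "x \<in> carrier G" for x
    using add_split[of "\<one>\<^bsub>G\<^esub>" "\<one>\<^bsub>G\<^esub>" x] x N.one_closed A.one_closed by simp
  have add_inv: "add (inv\<^bsub>G\<^esub> \<nu> x \<otimes>\<^bsub>G\<^esub> inv\<^bsub>G\<^esub> \<alpha> x) x = \<one>\<^bsub>G\<^esub>" if x: "x \<in> carrier G" for x
  proof -
    \<comment> \<open>The additive inverse inverts the two factors separately; it is not the inverse in \<open>G\<close>.\<close>
    have "add (inv\<^bsub>G\<^esub> \<nu> x \<otimes>\<^bsub>G\<^esub> inv\<^bsub>G\<^esub> \<alpha> x) x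
        = inv\<^bsub>G\<^esub> \<nu> x \<otimes>\<^bsub>G\<^esub> (\<nu> x \<otimes>\<^bsub>G\<^esub> \<alpha> x) \<otimes>\<^bsub>G\<^esub> inv\<^bsub>G\<^esub> \<alpha> x"
      using add_split[of "inv\<^bsub>G\<^esub> \<nu> x" "inv\<^bsub>G\<^esub> \<alpha> x" x] x \<nu> \<alpha> split[OF x] by simp
    then show ?thesis using x by (simp add: N.inv_solve_left' N.m_assoc)
  qed
  define B where "B = \<lparr>carrier = carrier G, monoid.mult = add, one = \<one>\<^bsub>G\<^esub>\<rparr>"
  have "comm_group B"
  proof (rule comm_groupI)
    fix x assume x: "x \<in> carrier B"
    then show "\<exists>y\<in>carrier B. y \<otimes>\<^bsub>B\<^esub> x = \<one>\<^bsub>B\<^esub>"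
      using add_inv[of x]
      by (intro bexI[of _ "inv\<^bsub>G\<^esub> \<nu> x \<otimes>\<^bsub>G\<^esub> inv\<^bsub>G\<^esub> \<alpha> x"]) (auto simp: B_def)
  qed (auto simp: B_def add_closed add_assoc add_one intro: add_comm)
  moreover have "lam g \<in> hom B B" if g: "g \<in> carrier G" for g
  proof (rule homI)
    fix x assume "x \<in> carrier B"
    then show "lam g x \<in> carrier B" using g by (simp add: B_def lam_def)
  next
    fix x y assume "x \<in> carrier B" "y \<in> carrier B"
    then have x: "x \<in> carrier G" and y: "y \<in> carrier G" by (simp_all add: B_def)
    let ?a = "\<alpha> g"
    have a: "?a \<in> A" "?a \<in> carrier G" using g \<alpha> by simp_all
    have swap: "\<alpha> x \<otimes>\<^bsub>G\<^esub> inv\<^bsub>G\<^esub> ?a = inv\<^bsub>G\<^esub> ?a \<otimes>\<^bsub>G\<^esub> \<alpha> x"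
      using A_comm[OF \<alpha>[OF x] A.m_inv_closed[OF a(1)]] .
    have "lam g x = ?a \<otimes>\<^bsub>G\<^esub> (\<nu> x \<otimes>\<^bsub>G\<^esub> \<alpha> x) \<otimes>\<^bsub>G\<^esub> inv\<^bsub>G\<^esub> ?a"
      using split[OF x] by (simp add: lam_def)
    also have "\<dots> = (?a \<otimes>\<^bsub>G\<^esub> \<nu> x \<otimes>\<^bsub>G\<^esub> inv\<^bsub>G\<^esub> ?a) \<otimes>\<^bsub>G\<^esub> \<alpha> x"
      using x a by (simp add: N.m_assoc swap)
    \<comment> \<open>This factors \<open>lam g x\<close> over \<open>N\<close> and \<open>A\<close>, with \<open>\<alpha> x\<close> as the factor in \<open>A\<close>.\<close>
    finally have "add (lam g x) (lam g y)
        = (?a \<otimes>\<^bsub>G\<^esub> \<nu> x \<otimes>\<^bsub>G\<^esub> inv\<^bsub>G\<^esub> ?a) \<otimes>\<^bsub>G\<^esub> (?a \<otimes>\<^bsub>G\<^esub> y \<otimes>\<^bsub>G\<^esub> inv\<^bsub>G\<^esub> ?a) \<otimes>\<^bsub>G\<^esub> \<alpha> x"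
      using add_split[OF conj_N[OF a(1) \<nu>[OF x]] \<alpha>[OF x], of "lam g y"] y a
      by (simp add: lam_def)
    also have "\<dots> = ?a \<otimes>\<^bsub>G\<^esub> \<nu> x \<otimes>\<^bsub>G\<^esub> (inv\<^bsub>G\<^esub> ?a \<otimes>\<^bsub>G\<^esub> ?a) \<otimes>\<^bsub>G\<^esub> y \<otimes>\<^bsub>G\<^esub> (inv\<^bsub>G\<^esub> ?a \<otimes>\<^bsub>G\<^esub> \<alpha> x)"
      using x y a by (simp add: N.m_assoc del: N.l_inv N.r_inv N.Units_l_inv N.Units_r_inv)
    also have "\<dots> = lam g (add x y)"
      using x y a by (simp add: lam_def add_def N.m_assoc swap)
    finally show "lam g (x \<otimes>\<^bsub>B\<^esub> y) = lam g x \<otimes>\<^bsub>B\<^esub> lam g y" by (simp add: B_def)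
  qed
  moreover have "x \<otimes>\<^bsub>G\<^esub> y = x \<otimes>\<^bsub>B\<^esub> lam x y" if x: "x \<in> carrier G" and y: "y \<in> carrier G" for x y
  proof -
    have "x \<otimes>\<^bsub>B\<^esub> lam x y = (\<nu> x \<otimes>\<^bsub>G\<^esub> \<alpha> x) \<otimes>\<^bsub>G\<^esub> y"
      using x y by (simp add: B_def add_def lam_def N.m_assoc)
    then show ?thesis using split[OF x] by simp
  qed
  ultimately have "left_brace G B lam"
    by (simp add: left_brace_def left_brace_axioms_def N.is_group B_def)
  then show thesis by (rule that)
qed

section \<open>Cyclic quotients\<close>

lemma (in normal) cyclic_supplement_if_cyclic_quotient:
  assumes "cyclic_group (G Mod H)"
  obtains g where "g \<in> carrier G" "carrier G = H <#>\<^bsub>G\<^esub> range (\<lambda>k::int. g [^]\<^bsub>G\<^esub> k)"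
proof -
  interpret Q: group "G Mod H" by (rule factorgroup_is_group)
  interpret q: group_hom G "G Mod H" "\<lambda>a. H #> a"
    using r_coset_hom_Mod by (simp add: group_hom_def group_hom_axioms_def is_group Q.is_group)
  obtain c where c: "c \<in> carrier (G Mod H)"
    and gen: "carrier (G Mod H) = range (\<lambda>k::int. c [^]\<^bsub>G Mod H\<^esub> k)"
    using assms by (auto simp: Q.cyclic_group)
  obtain g where g: "g \<in> carrier G" "c = H #> g"
    using c by (auto simp: carrier_FactGroup)
  have "x \<in> H <#> range (\<lambda>k::int. g [^] k)" if x: "x \<in> carrier G" for x
  proof -
    have "H #> x \<in> carrier (G Mod H)" using x by (rule q.hom_closed)
    then obtain k :: int where "H #> x = c [^]\<^bsub>G Mod H\<^esub> k"
      using gen by auto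
    then have "H #> x = H #> (g [^] k)"
      using q.hom_int_pow[OF g(1), of k] g(2) by simp
    then have "x \<in> H #> (g [^] k)"
      using rcos_self[OF x subgroup_axioms] by simp
    then show ?thesis by (auto simp: r_coset_def set_mult_def)
  qed
  moreover have "H <#> range (\<lambda>k::int. g [^] k) \<subseteq> carrier G"
    using g(1) subset by (auto simp: set_mult_def)
  ultimately show thesis using that[OF g(1)] by blast
qed

lemma (in group) comm_group_range_int_pow:
  assumes g: "g \<in> carrier G"
  shows "subgroup (range (\<lambda>k::int. g [^] k)) G"
    and "comm_group (G\<lparr>carrier := range (\<lambda>k::int. g [^] k)\<rparr>)"
proof -
  let ?A = "range (\<lambda>k::int. g [^] k)"
  show A: "subgroup ?A G"
    using generate_pow[OF g] generate_is_subgroup[of "{g}"] g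
    by (simp add: full_SetCompr_eq)
  show "comm_group (G\<lparr>carrier := ?A\<rparr>)"
  proof (rule group.group_comm_groupI)
    show "group (G\<lparr>carrier := ?A\<rparr>)" using A by (rule subgroup.subgroup_is_group[OF _ is_group])
  qed (use g in \<open>auto simp: int_pow_mult[symmetric] add.commute\<close>)
qed

theorem corollary3p9:
  fixes G :: "('a, 'b) monoid_scheme"
  assumes "group G" and "finite (carrier G)"
  shows "(\<forall>N A. N \<lhd> G \<and> subgroup A G
            \<and> comm_group (G\<lparr>carrier := N\<rparr>) \<and> comm_group (G\<lparr>carrier := A\<rparr>)
            \<and> carrier G = N <#>\<^bsub>G\<^esub> A \<longrightarrow> IYB_group G)
         \<and> (abelian_by_cyclic G \<longrightarrow> IYB_group G)"
proof -
  have product: "IYB_group G"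
    if "N \<lhd> G" "subgroup A G" "comm_group (G\<lparr>carrier := N\<rparr>)" "comm_group (G\<lparr>carrier := A\<rparr>)"
      "carrier G = N <#>\<^bsub>G\<^esub> A" for N A
    using left_brace_of_abelian_factorization[OF that] left_brace.IYB_group assms(2) by metis
  moreover have "IYB_group G" if cyc: "abelian_by_cyclic G"
  proof -
    obtain N where N: "N \<lhd> G" "comm_group (G\<lparr>carrier := N\<rparr>)" "cyclic_group (G Mod N)"
      using cyc by (auto simp: abelian_by_cyclic_def)
    obtain g where g: "g \<in> carrier G" "carrier G = N <#>\<^bsub>G\<^esub> range (\<lambda>k::int. g [^]\<^bsub>G\<^esub> k)"
      using normal.cyclic_supplement_if_cyclic_quotient[OF N(1,3)] by blast
    show ?thesis
      using product[OF N(1) _ N(2) _ g(2)] group.comm_group_range_int_pow[OF assms(1) g(1)] by blast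
  qed
  ultimately show ?thesis by blast
qed

end
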